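(* Consider a convex optimization problem with objective function $f_0$ and feasible set $D \subseteq \mathbb{R}^n$ (a convex set), and suppose $f_0$ is strictly convex on $D$. Then the optimal solution, if it exists, is unique; that is, there is at most one $x \in D$ with $f_0(x) \leq f_0(z)$ for all $z \in D$.
   Context: A convex optimization problem has the form: minimize $f_0(x)$ subject to $f_i(x) \leq 0$ for $i = 1, \dots, m$ and $h_i(x) = 0$ for $i = 1, \dots, p$, where $f_0, \dots, f_m$ are convex functions (real-valued with convex domains in $\mathbb{R}^n$) and each $h_i(x) = a_i^T x - b_i$ is affine. The feasible set $D$ is the set of points in the domains of all of $f_0,\dots,f_m$ that satisfy all the constraints; it is convex. A function $f_0$ is strictly convex on the convex set $D$ if $f_0(\theta x + (1-\theta) y) < \theta f_0(x) + (1-\theta) f_0(y)$ for all $x, y \in D$ with $x \neq y$ and all $0 < \theta < 1$. An optimal solution is a feasible point at which $f_0$ attains its minimum over $D$. *)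

theory Defs
  imports "HOL-Analysis.Analysis"
begin

text \<open>
  The data of a problem are the numbers \<open>m\<close>, \<open>p\<close> of inequality and equality constraints, the
  functions \<open>f 0, ..., f m\<close> with domains \<open>S 0, ..., S m\<close> (values of \<open>f i\<close> outside \<open>S i\<close> are
  irrelevant), and the coefficients \<open>a i\<close>, \<open>b i\<close> of the equality constraints. Here \<open>f 0\<close> is the
  objective. Convexity of each \<open>S i\<close> is part of the library's \<^const>\<open>convex_on\<close>.
\<close>

definition convex_problem ::
  "nat \<Rightarrow> (nat \<Rightarrow> real ^ 'n \<Rightarrow> real) \<Rightarrow> (nat \<Rightarrow> (real ^ 'n) set) \<Rightarrow> bool"
  where "convex_problem m f S \<longleftrightarrow> (\<forall>i\<in>{0..m}. convex_on (S i) (f i))"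

definition feasible_set ::
  "nat \<Rightarrow> nat \<Rightarrow> (nat \<Rightarrow> real ^ 'n \<Rightarrow> real) \<Rightarrow> (nat \<Rightarrow> (real ^ 'n) set)
    \<Rightarrow> (nat \<Rightarrow> real ^ 'n) \<Rightarrow> (nat \<Rightarrow> real) \<Rightarrow> (real ^ 'n) set"
  where "feasible_set m p f S a b =
    {x. (\<forall>i\<in>{0..m}. x \<in> S i) \<and> (\<forall>i\<in>{1..m}. f i x \<le> 0) \<and> (\<forall>i\<in>{1..p}. a i \<bullet> x - b i = 0)}"

definition strictly_convex_on :: "'a::real_vector set \<Rightarrow> ('a \<Rightarrow> real) \<Rightarrow> bool"
  where "strictly_convex_on D g \<longleftrightarrow> convex D \<and>
    (\<forall>x\<in>D. \<forall>y\<in>D. \<forall>\<theta>. x \<noteq> y \<and> 0 < \<theta> \<and> \<theta> < 1 \<longrightarrow>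
      g (\<theta> *\<^sub>R x + (1 - \<theta>) *\<^sub>R y) < \<theta> * g x + (1 - \<theta>) * g y)"

definition optimal_solution :: "('a \<Rightarrow> real) \<Rightarrow> 'a set \<Rightarrow> 'a \<Rightarrow> bool"
  where "optimal_solution g D x \<longleftrightarrow> x \<in> D \<and> (\<forall>z\<in>D. g x \<le> g z)"

text \<open>The conjunct \<^term>\<open>convex D\<close> above is automatic for feasible sets of convex problems:\<close>

lemma convex_feasible_set:
  fixes S :: "nat \<Rightarrow> (real ^ 'n) set"
  assumes "convex_problem m f S"
  shows "convex (feasible_set m p f S a b)"
proof (rule convexI)
  fix x y :: "real ^ 'n" and u v :: real
  assume x: "x \<in> feasible_set m p f S a b" and y: "y \<in> feasible_set m p f S a b"
    and uv: "0 \<le> u" "0 \<le> v" "u + v = 1"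
  have cv: "convex_on (S i) (f i)" if "i \<in> {0..m}" for i
    using assms that by (auto simp: convex_problem_def)
  have 1: "u *\<^sub>R x + v *\<^sub>R y \<in> S i" if i: "i \<in> {0..m}" for i
    using cv[OF i] x y uv i by (auto simp: convex_on_def feasible_set_def intro: convexD)
  have 2: "f i (u *\<^sub>R x + v *\<^sub>R y) \<le> 0" if i: "i \<in> {1..m}" for i
  proof -
    have "f i (u *\<^sub>R x + v *\<^sub>R y) \<le> u * f i x + v * f i y"
      using cv[of i] x y uv i by (auto simp: convex_on_def feasible_set_def)
    also have "\<dots> \<le> 0"
      using x y uv i by (intro add_nonpos_nonpos mult_nonneg_nonpos) (auto simp: feasible_set_def)
    finally show ?thesis .
  qed
  have 3: "a i \<bullet> (u *\<^sub>R x + v *\<^sub>R y) - b i = 0" if i: "i \<in> {1..p}" for i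
  proof -
    have "a i \<bullet> x = b i" "a i \<bullet> y = b i"
      using x y i by (auto simp: feasible_set_def)
    then have "a i \<bullet> (u *\<^sub>R x + v *\<^sub>R y) = (u + v) * b i"
      by (simp add: inner_add_right distrib_right)
    then show ?thesis using uv by simp
  qed
  show "u *\<^sub>R x + v *\<^sub>R y \<in> feasible_set m p f S a b"
    using 1 2 3 by (simp add: feasible_set_def)
qed

end

theory Submission
  imports Defs
begin

text \<open>
  Strict convexity pushes the value at the midpoint of two distinct points strictly below the
  average of their values. If both points were minimizers, that average would be the minimum, and
  the midpoint, which lies in the set by convexity, would undercut it.
\<close>

lemma strictly_convex_on_minimizer_unique:
  fixes g :: "'a::real_vector \<Rightarrow> real"
  assumes g: "strictly_convex_on D g"
    and x: "optimal_solution g D x" and y: "optimal_solution g D y"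
  shows "x = y"
proof (rule ccontr)
  assume "x \<noteq> y"
  have D: "convex D" "x \<in> D" "y \<in> D"
    using g x y by (auto simp: strictly_convex_on_def optimal_solution_def)
  define z where "z = (1/2) *\<^sub>R x + (1 - 1/2) *\<^sub>R y"
  have "z \<in> D"
    unfolding z_def using D by (intro convexD) auto
  then have "g x \<le> g z" "g y \<le> g z"
    using x y by (auto simp: optimal_solution_def)
  moreover have "g z < (1/2) * g x + (1 - 1/2) * g y"
  proof -
    have "0 < (1/2::real)" "(1/2::real) < 1" by simp_all
    then show ?thesis
      using g D \<open>x \<noteq> y\<close> unfolding strictly_convex_on_def z_def by blast
  qed
  ultimately show False by simp
qed

theorem theorem9:
  fixes m p :: nat
    and f :: "nat \<Rightarrow> real ^ 'n \<Rightarrow> real"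
    and S :: "nat \<Rightarrow> (real ^ 'n) set"
    and a :: "nat \<Rightarrow> real ^ 'n"
    and b :: "nat \<Rightarrow> real"
  assumes "convex_problem m f S"
    and "strictly_convex_on (feasible_set m p f S a b) (f 0)"
  shows "\<exists>\<^sub>\<le>\<^sub>1 x. optimal_solution (f 0) (feasible_set m p f S a b) x"
  using assms(2) by (intro Uniq_I) (rule strictly_convex_on_minimizer_unique)

end
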